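(* Consider the linear regression model $Y=\beta'\mathbf{x}+\varepsilon$, where $\beta\in\mathbb{R}^p$ is an unknown parameter vector, $\mathbf{x}$ is a $p$-dimensional covariate with a certain (single, classical) distribution $F_{\mathbf{x}}$, and the error $\varepsilon$, independent of $\mathbf{x}$, is defined on a sublinear expectation space $(\Omega,\mathcal{H},\mathbb{E})$. Write $\overline\mu=\mathbb{E}[\varepsilon]$ and $\underline\mu=-\mathbb{E}[-\varepsilon]$, and suppose $\underline\mu<\overline\mu$. (1) Given $\mathbf{x}$, the sublinear expectation of $Y$ has a shift $\overline\mu$: $$\mathbb{E}[Y|\mathbf{x}]=\beta'\mathbf{x}+\overline\mu.$$ (2) If in addition $E[\mathbf{x}\mathbf{x}']$ is a positive definite matrix, then $\beta$ is identifiable; more precisely, $\beta$ is uniquely expressed by $$\beta=(E[\mathbf{x}\mathbf{x}'])^{-1}E\{\mathbf{x}\,\mathbb{E}[Y|\mathbf{x}]\}-\overline\mu\,(E[\mathbf{x}\mathbf{x}'])^{-1}E[\mathbf{x}].$$ Particularly, if $E[\mathbf{x}]=0$, then $$\beta=(E[\mathbf{x}\mathbf{x}'])^{-1}E\{\mathbf{x}\,\mathbb{E}[Y|\mathbf{x}]\}.$$ Here the linear expectation $E$ is taken under the distribution $F_{\mathbf{x}}$.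
   Context: A prime denotes transpose. Let $\Omega$ be a set and $\mathcal{H}$ a linear space of real-valued functions on $\Omega$. A sublinear expectation is a map $\mathbb{E}:\mathcal{H}\to\mathbb{R}$ such that for all $U,V\in\mathcal{H}$: (i) $U\ge V$ implies $\mathbb{E}[U]\ge\mathbb{E}[V]$; (ii) $\mathbb{E}[c]=c$ for constants $c$; (iii) $\mathbb{E}[U+V]\le\mathbb{E}[U]+\mathbb{E}[V]$; (iv) $\mathbb{E}[\lambda U]=\lambda\mathbb{E}[U]$ for $\lambda\ge0$. The triple $(\Omega,\mathcal{H},\mathbb{E})$ is a sublinear expectation space. It is assumed that $\mathcal{H}$ contains linear and quadratic functions of $\varepsilon$. The conditional sublinear expectation is defined by $\mathbb{E}[Y|\mathbf{x}]=\sup_{f_{Y|\mathbf{x}}\in\mathcal{F}_{Y|\mathbf{x}}}E_{f_{Y|\mathbf{x}}}[Y|\mathbf{x}]$, where $\{E_{f_{Y|\mathbf{x}}}\}$ is a family of conditional linear expectations. It satisfies properties (i)-(iv) conditionally on $\mathbf{x}$, with $\mathbf{x}$ treated as fixed (constant) under the conditioning. Since $\varepsilon$ is independent of $\mathbf{x}$, $\mathbb{E}[\varepsilon|\mathbf{x}]=\mathbb{E}[\varepsilon]$. *)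

theory Defs
  imports "HOL-Probability.Probability"
begin

text \<open>
  The set \<open>\<Omega>\<close> is the type \<open>'w\<close>; a linear space of real functions on it is a set \<open>H\<close>, and
  functionals are total on \<open>'w \<Rightarrow> real\<close> but only constrained on \<open>H\<close>. Constants belong to \<open>H\<close>
  because the axiom on constants evaluates the expectation there.
\<close>

definition function_space :: "('w \<Rightarrow> real) set \<Rightarrow> bool" where
  "function_space H \<longleftrightarrow>
     (\<forall>c. (\<lambda>_. c) \<in> H) \<and>
     (\<forall>U\<in>H. \<forall>V\<in>H. (\<lambda>w. U w + V w) \<in> H) \<and>
     (\<forall>a. \<forall>U\<in>H. (\<lambda>w. a * U w) \<in> H)"

definition sublinear_expectation_space ::
  "('w \<Rightarrow> real) set \<Rightarrow> (('w \<Rightarrow> real) \<Rightarrow> real) \<Rightarrow> bool" where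
  "sublinear_expectation_space H \<E> \<longleftrightarrow>
     function_space H \<and>
     (\<forall>U\<in>H. \<forall>V\<in>H. (\<forall>w. U w \<ge> V w) \<longrightarrow> \<E> U \<ge> \<E> V) \<and>
     (\<forall>c. \<E> (\<lambda>_. c) = c) \<and>
     (\<forall>U\<in>H. \<forall>V\<in>H. \<E> (\<lambda>w. U w + V w) \<le> \<E> U + \<E> V) \<and>
     (\<forall>a\<ge>0. \<forall>U\<in>H. \<E> (\<lambda>w. a * U w) = a * \<E> U)"

definition linear_expectation ::
  "('w \<Rightarrow> real) set \<Rightarrow> (('w \<Rightarrow> real) \<Rightarrow> real) \<Rightarrow> bool" where
  "linear_expectation H L \<longleftrightarrow>
     function_space H \<and>
     (\<forall>U\<in>H. \<forall>V\<in>H. (\<forall>w. U w \<ge> V w) \<longrightarrow> L U \<ge> L V) \<and>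
     (\<forall>c. L (\<lambda>_. c) = c) \<and>
     (\<forall>U\<in>H. \<forall>V\<in>H. L (\<lambda>w. U w + V w) = L U + L V) \<and>
     (\<forall>a. \<forall>U\<in>H. L (\<lambda>w. a * U w) = a * L U)"

text \<open>
  Quantities depending on both the covariate and the error are functions \<open>U (x, w)\<close> of the covariate
  value \<open>x\<close> and the sample point \<open>w\<close>; those whose sections at every fixed \<open>x\<close> lie in \<open>H\<close> can be
  evaluated conditionally on the covariate.
\<close>

definition joint_space :: "('w \<Rightarrow> real) set \<Rightarrow> ('x \<times> 'w \<Rightarrow> real) set" where
  "joint_space H = {U. \<forall>x. (\<lambda>w. U (x, w)) \<in> H}"

text \<open>
  \<open>\<F> x\<close> is the family of conditional linear expectations given that the covariate equals \<open>x\<close>. The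
  equation in the definition says that the covariate is a constant under the conditioning; \<open>\<F> x\<close> may
  otherwise depend on \<open>x\<close> arbitrarily. Boundedness makes the supremum a real number.
\<close>

definition conditional_family ::
  "('w \<Rightarrow> real) set \<Rightarrow> ('x \<Rightarrow> (('x \<times> 'w \<Rightarrow> real) \<Rightarrow> real) set) \<Rightarrow> bool" where
  "conditional_family H \<F> \<longleftrightarrow>
     (\<forall>x. \<F> x \<noteq> {} \<and>
          (\<forall>L\<in>\<F> x. linear_expectation (joint_space H) L \<and>
             (\<forall>U\<in>joint_space H. L U = L (\<lambda>(_, w). U (x, w)))) \<and>
          (\<forall>U\<in>joint_space H. bdd_above ((\<lambda>L. L U) ` \<F> x)))"

definition cond_expectation ::
  "('x \<Rightarrow> (('x \<times> 'w \<Rightarrow> real) \<Rightarrow> real) set) \<Rightarrow> ('x \<times> 'w \<Rightarrow> real) \<Rightarrow> 'x \<Rightarrow> real" where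
  "cond_expectation \<F> U x = (SUP L\<in>\<F> x. L U)"

lemma cond_expectation_sublinear:
  fixes H :: "('w \<Rightarrow> real) set" and x :: 'x
  assumes "conditional_family H \<F>"
  shows "sublinear_expectation_space (joint_space H) (\<lambda>U. cond_expectation \<F> U x)"
proof -
  let ?J = "joint_space H :: ('x \<times> 'w \<Rightarrow> real) set"
  have ne: "\<F> x \<noteq> {}"
    and lin: "\<And>L. L \<in> \<F> x \<Longrightarrow> linear_expectation ?J L"
    and bdd: "\<And>U. U \<in> ?J \<Longrightarrow> bdd_above ((\<lambda>L. L U) ` \<F> x)"
    using assms by (simp_all add: conditional_family_def)
  obtain L\<^sub>0 where "L\<^sub>0 \<in> \<F> x" using ne by blast
  then have fs: "function_space ?J"
    using lin[of L\<^sub>0] unfolding linear_expectation_def by blast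
  have mono: "cond_expectation \<F> V x \<le> cond_expectation \<F> U x"
    if "U \<in> ?J" "V \<in> ?J" "\<forall>w. V w \<le> U w" for U V
    unfolding cond_expectation_def
  proof (rule cSUP_mono[OF ne bdd[OF that(1)]])
    fix L assume "L \<in> \<F> x"
    then show "\<exists>L'\<in>\<F> x. L V \<le> L' U"
      using that lin[of L] unfolding linear_expectation_def by blast
  qed
  have const: "cond_expectation \<F> (\<lambda>_. c) x = c" for c
  proof -
    have "L (\<lambda>_. c) = c" if "L \<in> \<F> x" for L
      using lin[OF that] unfolding linear_expectation_def by blast
    then have "cond_expectation \<F> (\<lambda>_. c) x = (SUP L\<in>\<F> x. c)"
      unfolding cond_expectation_def by (intro SUP_cong) simp_all
    then show ?thesis using ne by simp
  qed
  have add: "cond_expectation \<F> (\<lambda>w. U w + V w) x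
      \<le> cond_expectation \<F> U x + cond_expectation \<F> V x"
    if "U \<in> ?J" "V \<in> ?J" for U V
    unfolding cond_expectation_def
  proof (rule cSUP_least[OF ne])
    fix L assume L: "L \<in> \<F> x"
    have "L (\<lambda>w. U w + V w) = L U + L V"
      using lin[OF L] that unfolding linear_expectation_def by blast
    also have "\<dots> \<le> (SUP L\<in>\<F> x. L U) + (SUP L\<in>\<F> x. L V)"
      by (intro add_mono cSUP_upper L bdd that)
    finally show "L (\<lambda>w. U w + V w) \<le> (SUP L\<in>\<F> x. L U) + (SUP L\<in>\<F> x. L V)" .
  qed
  have scale: "cond_expectation \<F> (\<lambda>w. a * U w) x = a * cond_expectation \<F> U x"
    if "a \<ge> 0" "U \<in> ?J" for a U
  proof -
    have "L (\<lambda>w. a * U w) = a * L U" if "L \<in> \<F> x" for L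
      using lin[OF that] \<open>U \<in> ?J\<close> unfolding linear_expectation_def by blast
    then have "cond_expectation \<F> (\<lambda>w. a * U w) x = (SUP L\<in>\<F> x. a * L U)"
      unfolding cond_expectation_def by (intro SUP_cong) simp_all
    also have "\<dots> = a * cond_expectation \<F> U x"
      unfolding cond_expectation_def using ne bdd[OF that(2)] that(1)
      by (subst continuous_at_Sup_mono[where f = "\<lambda>r. a * r"])
         (auto simp: image_image mono_def mult_left_mono intro!: continuous_intros)
    finally show ?thesis .
  qed
  show ?thesis
    unfolding sublinear_expectation_space_def using fs mono const add scale by blast
qed

text \<open>
  Independence of the error from the covariate: the conditional sublinear law of \<open>\<epsilon>\<close> given any
  covariate value is its unconditional sublinear law. The choice \<open>\<phi> = (\<lambda>t. t)\<close> gives that the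
  conditional and the unconditional sublinear expectation of \<open>\<epsilon>\<close> agree.
\<close>

definition independent_error ::
  "('w \<Rightarrow> real) set \<Rightarrow> (('w \<Rightarrow> real) \<Rightarrow> real) \<Rightarrow>
   ('x \<Rightarrow> (('x \<times> 'w \<Rightarrow> real) \<Rightarrow> real) set) \<Rightarrow> ('w \<Rightarrow> real) \<Rightarrow> bool" where
  "independent_error H \<E> \<F> \<epsilon> \<longleftrightarrow>
     (\<forall>\<phi> x. (\<lambda>w. \<phi> (\<epsilon> w)) \<in> H \<longrightarrow>
        cond_expectation \<F> (\<lambda>(_, w). \<phi> (\<epsilon> w)) x = \<E> (\<lambda>w. \<phi> (\<epsilon> w)))"

text \<open>
  The covariate is the coordinate variable on its own value space, so its classical distribution is
  the Borel probability measure \<open>F\<close>.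
\<close>

locale sublinear_regression =
  fixes F :: "(real ^ 'p) measure"
    and H :: "('w \<Rightarrow> real) set"
    and \<E> :: "('w \<Rightarrow> real) \<Rightarrow> real"
    and \<F> :: "real ^ 'p \<Rightarrow> (((real ^ 'p) \<times> 'w \<Rightarrow> real) \<Rightarrow> real) set"
    and \<epsilon> :: "'w \<Rightarrow> real"
  assumes covariate_prob: "prob_space F"
    and covariate_borel: "sets F = sets borel"
    and sublinear: "sublinear_expectation_space H \<E>"
    and error_quadratic: "\<And>a b c. (\<lambda>w. a + b * \<epsilon> w + c * (\<epsilon> w)\<^sup>2) \<in> H"
    and cond_family: "conditional_family H \<F>"
    and error_indep: "independent_error H \<E> \<F> \<epsilon>"

definition response :: "real ^ 'p \<Rightarrow> ('w \<Rightarrow> real) \<Rightarrow> (real ^ 'p) \<times> 'w \<Rightarrow> real" where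
  "response \<beta> \<epsilon> = (\<lambda>(x, w). \<beta> \<bullet> x + \<epsilon> w)"

text \<open>
  A Bochner integral: it is the zero matrix when the second moments of \<open>F\<close> are not all finite, so its
  positive definiteness entails that they are.
\<close>

definition second_moment :: "(real ^ 'p) measure \<Rightarrow> real ^ 'p ^ 'p" where
  "second_moment F = (\<integral>x. (\<chi> i j. x $ i * x $ j) \<partial>F)"

definition mean :: "(real ^ 'p) measure \<Rightarrow> real ^ 'p" where
  "mean F = (\<integral>x. x \<partial>F)"

definition positive_definite :: "real ^ 'p ^ 'p \<Rightarrow> bool" where
  "positive_definite A \<longleftrightarrow> transpose A = A \<and> (\<forall>u. u \<noteq> 0 \<longrightarrow> u \<bullet> (A *v u) > 0)"

end

theory Submission
  imports Defs
begin

text \<open>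
  Conditionally on the covariate, \<open>\<beta> \<bullet> x\<close> is a constant, and a sublinear expectation commutes with
  adding a constant: subadditivity gives one inequality, and subadditivity applied after subtracting
  the constant again gives the other (\<open>sublinear_expectation_translate\<close>). With independence of the
  error this is the shift formula (\<open>cond_expectation_response\<close>).

  Hence the regression function is affine in \<open>x\<close>, and multiplying it by \<open>x\<close> and integrating gives
  \<open>E[x x'] \<beta> + \<mu> E[x]\<close>, where \<open>\<mu>\<close> is the upper mean of the error
  (\<open>integral_affine_times_covariate\<close>). A positive definite second moment
  matrix can be inverted, and solving for \<open>\<beta>\<close> gives the stated formula
  (\<open>coefficient_formula\<close>). Its right-hand side involves the regression function only through an
  integral under \<open>F\<close>, so it assigns the same coefficient to any two models with the same upper mean
  whose regression functions agree almost everywhere: identifiability is a consequence of the formula.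

  Finiteness of the moments comes from positive definiteness: if \<open>x x'\<close> were not integrable, the
  Bochner integral defining the second moment matrix would be zero.
\<close>

lemma sublinear_expectation_translate:
  assumes "sublinear_expectation_space H \<E>" and U: "U \<in> H"
  shows "\<E> (\<lambda>w. c + U w) = c + \<E> U"
proof (rule antisym)
  have const: "(\<lambda>_. b) \<in> H" "\<E> (\<lambda>_. b) = b" for b
    using assms(1) unfolding sublinear_expectation_space_def function_space_def by blast+
  have add: "V \<in> H \<Longrightarrow> W \<in> H \<Longrightarrow> (\<lambda>w. V w + W w) \<in> H"
    and sub: "V \<in> H \<Longrightarrow> W \<in> H \<Longrightarrow> \<E> (\<lambda>w. V w + W w) \<le> \<E> V + \<E> W" for V W
    using assms(1) unfolding sublinear_expectation_space_def function_space_def by blast+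
  show "\<E> (\<lambda>w. c + U w) \<le> c + \<E> U"
    using sub[OF const(1)[of c] U] by (simp add: const)
  have "\<E> (\<lambda>w. - c + (c + U w)) \<le> - c + \<E> (\<lambda>w. c + U w)"
    using sub[OF const(1)[of "- c"] add[OF const(1)[of c] U]] by (simp add: const)
  then show "c + \<E> U \<le> \<E> (\<lambda>w. c + U w)"
    by simp
qed

text \<open>
  Each member of the conditional family treats the covariate as the constant \<open>x\<close>, and this passes to
  the supremum. It turns the term \<open>\<beta> \<bullet> x\<close> of the response into a constant that can be translated away.
\<close>

lemma cond_expectation_freeze:
  assumes "conditional_family H \<F>" and "U \<in> joint_space H"
  shows "cond_expectation \<F> U x = cond_expectation \<F> (\<lambda>(_, w). U (x, w)) x"
  unfolding cond_expectation_def
proof (intro SUP_cong refl)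
  fix L assume "L \<in> \<F> x"
  then show "L U = L (\<lambda>(_, w). U (x, w))"
    using assms unfolding conditional_family_def by blast
qed

lemma (in sublinear_regression) cond_expectation_response:
  "cond_expectation \<F> (response \<beta> \<epsilon>) x = \<beta> \<bullet> x + \<E> \<epsilon>"
proof -
  have eps: "\<epsilon> \<in> H"
    using error_quadratic[of 0 1 0] by simp
  \<comment> \<open>Each section of the response is an affine function of the error.\<close>
  have "(\<lambda>w. \<beta> \<bullet> z + \<epsilon> w) \<in> H" for z
    using error_quadratic[of "\<beta> \<bullet> z" 1 0] by simp
  then have resp: "response \<beta> \<epsilon> \<in> joint_space H"
    by (simp add: joint_space_def response_def)
  have err: "(\<lambda>(_, w). \<epsilon> w) \<in> joint_space H"
    using eps by (simp add: joint_space_def)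
  have "cond_expectation \<F> (response \<beta> \<epsilon>) x
      = cond_expectation \<F> (\<lambda>z. \<beta> \<bullet> x + (case z of (_, w) \<Rightarrow> \<epsilon> w)) x"
    using cond_expectation_freeze[OF cond_family resp, of x]
    by (simp add: response_def case_prod_unfold)
  also have "\<dots> = \<beta> \<bullet> x + cond_expectation \<F> (\<lambda>(_, w). \<epsilon> w) x"
    by (rule sublinear_expectation_translate[OF cond_expectation_sublinear[OF cond_family] err])
  also have "cond_expectation \<F> (\<lambda>(_, w). \<epsilon> w) x = \<E> \<epsilon>"
    using error_indep[unfolded independent_error_def, THEN spec[of _ "\<lambda>t. t"]] eps by simp
  finally show ?thesis .
qed

lemma matrix_inv_left:
  assumes "invertible A"
  shows "matrix_inv A ** A = mat 1"
  using assms someI_ex[of "\<lambda>B. A ** B = mat 1 \<and> B ** A = mat 1"]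
  unfolding invertible_def matrix_inv_def by blast

lemma positive_definite_imp_invertible:
  assumes "positive_definite A"
  shows "invertible A"
proof -
  have "u = 0" if "A *v u = 0" for u
    using assms that unfolding positive_definite_def by fastforce
  then show ?thesis
    by (simp add: invertible_left_inverse matrix_left_invertible_ker)
qed

text \<open>
  Without integrability the integral takes its default value, the zero matrix, whose quadratic form
  vanishes on every unit vector.
\<close>

lemma integrable_outer_product:
  assumes "positive_definite (second_moment F)"
  shows "integrable F (\<lambda>x. \<chi> i j. x $ i * x $ j)"
proof (rule ccontr)
  assume "\<not> integrable F (\<lambda>x. \<chi> i j. x $ i * x $ j)"
  then have "second_moment F = 0"
    by (simp add: second_moment_def not_integrable_integral_eq)
  moreover have "(axis undefined 1 :: real ^ 'a) \<noteq> 0"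
    by (simp add: axis_eq_0_iff)
  ultimately show False
    using assms unfolding positive_definite_def by force
qed

lemma outer_product_vector_mult:
  fixes x \<beta> :: "real ^ 'p"
  shows "(\<chi> i j. x $ i * x $ j) *v \<beta> = (\<beta> \<bullet> x) *\<^sub>R x"
  by (simp add: vec_eq_iff matrix_vector_mult_def inner_vec_def sum_distrib_left
      sum_distrib_right mult_ac)

lemma bounded_linear_matrix_vector_mult_left:
  fixes \<beta> :: "real ^ 'p"
  shows "bounded_linear (\<lambda>A :: real ^ 'p ^ 'q. A *v \<beta>)"
  unfolding linear_conv_bounded_linear[symmetric]
  by (intro linearI) (simp_all add: matrix_vector_mult_add_rdistrib scaleR_matrix_vector_assoc)

text \<open>
  On a probability space a finite second moment forces a finite first moment, since
  \<open>norm x \<le> 1 + x \<bullet> x\<close>; here \<open>x \<bullet> x\<close> is the trace of the matrix \<open>x x'\<close>, so it is integrable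
  whenever that matrix is.
\<close>

lemma integrable_covariate:
  fixes F :: "(real ^ 'p) measure"
  assumes "prob_space F" and "sets F = sets borel"
    and "integrable F (\<lambda>x. \<chi> i j. x $ i * x $ j)"
  shows "integrable F (\<lambda>x. x)"
proof -
  interpret prob_space F by fact
  have "bounded_linear (\<lambda>A :: real ^ 'p ^ 'p. trace A)"
    unfolding linear_conv_bounded_linear[symmetric]
    by (intro linearI) (simp_all add: trace_def sum.distrib sum_distrib_left)
  from integrable_bounded_linear[OF this assms(3)]
  have "integrable F (\<lambda>x. x \<bullet> x)"
    by (simp add: trace_def inner_vec_def)
  then have int: "integrable F (\<lambda>x. 1 + x \<bullet> x)"
    by simp
  have "norm x \<le> 1 + x \<bullet> x" for x :: "real ^ 'p"
  proof -
    have "norm x * 2 \<le> 1 + (norm x)\<^sup>2"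
      using zero_le_power2[of "norm x - 1"] by (simp add: power2_diff)
    then show ?thesis
      unfolding power2_norm_eq_inner[symmetric] using norm_ge_zero[of x] by linarith
  qed
  then show ?thesis
    using assms(2) by (intro Bochner_Integration.integrable_bound[OF int])
      (auto simp: measurable_ident_sets intro!: order_trans[OF _ abs_ge_self])
qed

text \<open>
  Since \<open>(\<beta> \<bullet> x) x = (x x') \<beta>\<close>, and \<open>A \<mapsto> A \<beta>\<close> is a bounded linear map on matrices, the vector
  \<open>\<beta>\<close> can be pulled out of the integral.
\<close>

lemma integral_affine_times_covariate:
  fixes F :: "(real ^ 'p) measure"
  assumes "prob_space F" and "sets F = sets borel"
    and int: "integrable F (\<lambda>x. \<chi> i j. x $ i * x $ j)"
  shows "(\<integral>x. (\<beta> \<bullet> x + c) *\<^sub>R x \<partial>F) = second_moment F *v \<beta> + c *\<^sub>R mean F"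
proof -
  have "integrable F (\<lambda>x. (\<beta> \<bullet> x) *\<^sub>R x)"
    using integrable_bounded_linear[OF bounded_linear_matrix_vector_mult_left int, of \<beta>]
    by (simp add: outer_product_vector_mult)
  moreover have "(\<integral>x. (\<beta> \<bullet> x) *\<^sub>R x \<partial>F) = second_moment F *v \<beta>"
    using integral_bounded_linear[OF bounded_linear_matrix_vector_mult_left int, of \<beta>]
    by (simp add: outer_product_vector_mult second_moment_def)
  ultimately show ?thesis
    using integrable_covariate[OF assms] by (simp add: scaleR_left_distrib mean_def)
qed

text \<open>
  The hypothesis on \<open>g\<close> is only almost sure, so that the formula can be applied to two models whose
  regression functions agree outside a null set, with the regression function of one of them as \<open>g\<close>.
\<close>

lemma coefficient_formula:
  fixes F :: "(real ^ 'p) measure"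
  assumes "prob_space F" and borel: "sets F = sets borel"
    and pd: "positive_definite (second_moment F)"
    and [measurable]: "g \<in> borel_measurable F"
    and g: "AE x in F. g x = \<beta> \<bullet> x + c"
  shows "\<beta> = matrix_inv (second_moment F) *v (\<integral>x. g x *\<^sub>R x \<partial>F)
      - c *\<^sub>R (matrix_inv (second_moment F) *v mean F)"
proof -
  let ?M = "second_moment F"
  have [measurable]: "(\<lambda>x. x) \<in> F \<rightarrow>\<^sub>M borel"
    using borel by (rule measurable_ident_sets)
  have "(\<integral>x. g x *\<^sub>R x \<partial>F) = (\<integral>x. (\<beta> \<bullet> x + c) *\<^sub>R x \<partial>F)"
    using g by (intro integral_cong_AE) (measurable, auto)
  also have "\<dots> = ?M *v \<beta> + c *\<^sub>R mean F"
    using integral_affine_times_covariate[OF assms(1) borel integrable_outer_product[OF pd]] .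
  finally have "matrix_inv ?M *v (\<integral>x. g x *\<^sub>R x \<partial>F)
      = (matrix_inv ?M ** ?M) *v \<beta> + c *\<^sub>R (matrix_inv ?M *v mean F)"
    by (simp add: matrix_vector_right_distrib matrix_vector_mult_scaleR matrix_vector_mul_assoc)
  then show ?thesis
    using matrix_inv_left[OF positive_definite_imp_invertible[OF pd]] by simp
qed

theorem proposition2p2:
  fixes F :: "(real ^ 'p) measure"
    and H :: "('w \<Rightarrow> real) set"
    and \<E> :: "('w \<Rightarrow> real) \<Rightarrow> real"
    and \<F> :: "real ^ 'p \<Rightarrow> (((real ^ 'p) \<times> 'w \<Rightarrow> real) \<Rightarrow> real) set"
    and \<epsilon> :: "'w \<Rightarrow> real"
    and \<beta> :: "real ^ 'p"
    and Y :: "(real ^ 'p) \<times> 'w \<Rightarrow> real"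
    and \<mu>_upper \<mu>_lower :: real
  assumes "sublinear_regression F H \<E> \<F> \<epsilon>"
    and "Y = response \<beta> \<epsilon>"
    and "\<mu>_upper = \<E> \<epsilon>"
    and "\<mu>_lower = - \<E> (\<lambda>w. - \<epsilon> w)"
    and "\<mu>_lower < \<mu>_upper"
  shows "(\<forall>x. cond_expectation \<F> Y x = \<beta> \<bullet> x + \<mu>_upper) \<and>
    (positive_definite (second_moment F) \<longrightarrow>
      (\<forall>(H' :: ('v \<Rightarrow> real) set) \<E>' \<F>' \<epsilon>' \<beta>'.
         sublinear_regression F H' \<E>' \<F>' \<epsilon>' \<and> \<E>' \<epsilon>' = \<mu>_upper \<and>
         (AE x in F. cond_expectation \<F>' (response \<beta>' \<epsilon>') x = cond_expectation \<F> Y x)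
         \<longrightarrow> \<beta>' = \<beta>) \<and>
      \<beta> = matrix_inv (second_moment F) *v (\<integral>x. cond_expectation \<F> Y x *\<^sub>R x \<partial>F)
          - \<mu>_upper *\<^sub>R (matrix_inv (second_moment F) *v mean F) \<and>
      (mean F = 0 \<longrightarrow>
         \<beta> = matrix_inv (second_moment F) *v (\<integral>x. cond_expectation \<F> Y x *\<^sub>R x \<partial>F)))"
proof -
  interpret sublinear_regression F H \<E> \<F> \<epsilon> by fact
  let ?M = "second_moment F" and ?g = "cond_expectation \<F> Y"
  let ?b = "matrix_inv ?M *v (\<integral>x. ?g x *\<^sub>R x \<partial>F) - \<mu>_upper *\<^sub>R (matrix_inv ?M *v mean F)"
  have shift: "?g x = \<beta> \<bullet> x + \<mu>_upper" for x
    unfolding assms(2,3) by (rule cond_expectation_response)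
  have [measurable]: "(\<lambda>x. x) \<in> F \<rightarrow>\<^sub>M borel"
    using covariate_borel by (rule measurable_ident_sets)
  have meas: "?g \<in> borel_measurable F"
    unfolding shift[abs_def] by measurable
  have formula: "b = ?b"
    if "positive_definite ?M" and "AE x in F. ?g x = b \<bullet> x + \<mu>_upper" for b
    using coefficient_formula[OF covariate_prob covariate_borel that(1) meas that(2)] .
  have "\<beta>' = \<beta>"
    if pd: "positive_definite ?M"
      and model: "sublinear_regression F H' \<E>' \<F>' \<epsilon>'" and mean: "\<E>' \<epsilon>' = \<mu>_upper"
      and ae: "AE x in F. cond_expectation \<F>' (response \<beta>' \<epsilon>') x = ?g x"
    for H' :: "('v \<Rightarrow> real) set" and \<E>' \<F>' \<epsilon>' \<beta>'
  proof -
    have "AE x in F. ?g x = \<beta>' \<bullet> x + \<mu>_upper"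
      using ae unfolding sublinear_regression.cond_expectation_response[OF model] mean
      by (rule eventually_mono) simp
    then have "\<beta>' = ?b"
      by (rule formula[OF pd])
    also have "\<dots> = \<beta>"
      using formula[OF pd, of \<beta>] by (simp add: shift)
    finally show ?thesis .
  qed
  moreover have "\<beta> = ?b" if "positive_definite ?M"
    by (rule formula[OF that]) (simp add: shift)
  moreover from this have "\<beta> = matrix_inv ?M *v (\<integral>x. ?g x *\<^sub>R x \<partial>F)"
    if "positive_definite ?M" and "mean F = 0"
    using that by simp
  ultimately show ?thesis
    using shift by blast
qed

end
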